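(* Let $n\ge1$, $1\le m\le n$ and $1\le k_1<\dots<k_m\le 2n$. If $w\in\mathfrak{S}_{2n}$ is chosen uniformly at random, then the probability that all of the positions $w^{-1}(k_1),\dots,w^{-1}(k_m)$ belong to $\mathcal{A}(w)$ is \[\prod_{i=1}^m\frac{k_i-2i+1}{2n-2i+1}.\]
   Context: Crossout procedure: for $w\in\mathfrak{S}_{2n}$ in one-line notation $w(1)\cdots w(2n)$, repeat until all positions are marked: mark "B" at the unmarked position $i$ with smallest value $w(i)$, then mark "A" at the leftmost unmarked position. $\mathcal{A}(w)$ is the set of positions marked A (interpreted as the morsels eaten by Alice, where $w^{-1}(k)$ is the morsel Alice ranks $k$th worst). *)

theory Defs
  imports "HOL-Probability.Probability" "HOL-Combinatorics.Permutations"
begin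

text \<open>The set \<open>U\<close> consists of the positions that are still unmarked, and \<open>crossout_A w U\<close> is the
  set of positions that receive the mark A from then on. The procedure is only meaningful when
  \<open>card U\<close> is even, so that a position is left for A after each B; for other \<open>U\<close> the value is
  junk.\<close>

function crossout_A :: "(nat \<Rightarrow> nat) \<Rightarrow> nat set \<Rightarrow> nat set" where
  "crossout_A w U =
     (if finite U \<and> U \<noteq> {} then
        let b = arg_min_on w U;
            a = Min (U - {b})
        in insert a (crossout_A w (U - {b} - {a}))
      else {})"
  by pat_completeness auto
termination
proof (relation "Wellfounded.measure (\<lambda>(w, U). card U)")
  fix w :: "nat \<Rightarrow> nat" and U :: "nat set" and b a :: nat
  assume U: "finite U \<and> U \<noteq> {}" and b: "b = arg_min_on w U"
  have "b \<in> U" using U b arg_min_if_finite(1) by blast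
  then have "U - {b} - {a} \<subset> U" by blast
  then show "((w, U - {b} - {a}), (w, U)) \<in> Wellfounded.measure (\<lambda>(w, U). card U)"
    using U by (simp add: psubset_card_mono)
qed simp

declare crossout_A.simps [simp del]

definition alice_set :: "nat \<Rightarrow> (nat \<Rightarrow> nat) \<Rightarrow> nat set" where
  "alice_set n w = crossout_A w {1..2 * n}"

end

theory Submission imports Defs begin

text \<open>In each round the smallest remaining value \<open>\<mu>\<close> is marked B and, for uniformly random \<open>w\<close>, the
  value \<open>c\<close> marked A is uniform among the other remaining values; moreover the arrangement of what is
  left is again uniform. Conditioning on the position of \<open>\<mu>\<close> and on \<open>c\<close> gives a recursion for the
  number of arrangements in which all values of a set \<open>K\<close> are marked A. The closed form
  solves it because the sums over \<open>c \<notin> K\<close> and over \<open>c \<in> K\<close> both telescope.\<close>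

section \<open>Two telescoping sums of products\<close>

text \<open>Raise the factors from \<open>x k\<close> to \<open>x k + 1\<close> one at a time, from
  the largest \<open>k\<close> downwards. Raising the factor at \<open>c\<close> increases the
  product by exactly the summand for \<open>c\<close>, since the factors above \<open>c\<close> are
  already raised and those below are not. This sum handles the case that the value marked A lies in
  \<open>K\<close>.\<close>

lemma sum_prod_raise_above:
  fixes x :: "nat \<Rightarrow> real"
  assumes "finite K"
  shows "(\<Sum>c\<in>K. \<Prod>k\<in>K - {c}. x k + of_bool (c < k)) = (\<Prod>k\<in>K. x k + 1) - (\<Prod>k\<in>K. x k)"
  using assms
proof (induction K rule: finite_linorder_max_induct)
  case empty
  then show ?case by simp
next
  case (insert M K)
  have M: "M \<notin> K" using insert by auto
  have "(\<Prod>k\<in>insert M K - {c}. x k + of_bool (c < k))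
      = (x M + 1) * (\<Prod>k\<in>K - {c}. x k + of_bool (c < k))" if "c \<in> K" for c
  proof -
    have "insert M K - {c} = insert M (K - {c})" using that M by auto
    then show ?thesis using insert that M by simp
  qed
  moreover have "(\<Prod>k\<in>insert M K - {M}. x k + of_bool (M < k)) = (\<Prod>k\<in>K. x k)"
    using M insert by (intro prod.cong) auto
  ultimately have "(\<Sum>c\<in>insert M K. \<Prod>k\<in>insert M K - {c}. x k + of_bool (c < k))
      = (\<Prod>k\<in>K. x k) + (x M + 1) * (\<Sum>c\<in>K. \<Prod>k\<in>K - {c}. x k + of_bool (c < k))"
    using insert(1) M by (simp add: sum_distrib_left)
  then show ?case
    using insert.IH insert(1) M by (simp add: algebra_simps)
qed

text \<open>This sum handles a value \<open>c\<close> outside \<open>K\<close> being marked A. Peel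
  off the largest element \<open>M\<close> of \<open>K\<close> and cut \<open>V\<close> at
  \<open>M\<close>: values above \<open>M\<close> lower no factor, values below \<open>M\<close>
  lower the factor at \<open>M\<close> to \<open>x M - 1\<close>. By induction the values below
  \<open>M\<close> sum, over the other factors, to a multiple of their product with coefficient
  \<open>x M\<close>, so both contributions are multiples of the full product.\<close>

lemma sum_prod_lower_above:
  fixes V K :: "nat set"
  assumes "finite K" "finite V" "K \<subseteq> V" "\<mu> \<in> V" "\<forall>v\<in>V. \<mu> \<le> v" "\<mu> \<notin> K"
  defines "x \<equiv> \<lambda>k. real (card {v\<in>V. v \<le> k}) - 2 * real (card {j\<in>K. j \<le> k})"
  shows "(\<Sum>c\<in>V - {\<mu>} - K. \<Prod>k\<in>K. x k - of_bool (c < k))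
       = (real (card V) - 2 * real (card K) - 1) * (\<Prod>k\<in>K. x k)"
  using assms(1-6) unfolding x_def
proof (induction K arbitrary: V rule: finite_linorder_max_induct)
  case empty
  then have "card V = Suc (card (V - {\<mu>}))" by (intro card.remove)
  then show ?case by simp
next
  case (insert M K)
  note MK = \<open>\<forall>b\<in>K. b < M\<close>
  have M: "M \<notin> K" using MK by auto
  define W where "W = {v\<in>V. v < M}"
  define y where "y = (\<lambda>k. real (card {v\<in>V. v \<le> k}) - 2 * real (card {j\<in>insert M K. j \<le> k}))"
  have fW: "finite W" using insert.prems by (simp add: W_def)
  have \<mu>M: "\<mu> < M" using insert.prems by (metis insertI1 le_neq_implies_less subsetD)
  have yW: "y k = real (card {v\<in>W. v \<le> k}) - 2 * real (card {j\<in>K. j \<le> k})" if "k \<in> K" for k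
  proof -
    have "k < M" using that MK by auto
    then have "{v\<in>V. v \<le> k} = {v\<in>W. v \<le> k}" "{j\<in>insert M K. j \<le> k} = {j\<in>K. j \<le> k}"
      by (auto simp: W_def)
    then show ?thesis by (simp add: y_def)
  qed
  have VM: "{v\<in>V. v \<le> M} = insert M W" using insert.prems by (auto simp: W_def)
  have KM: "{j\<in>insert M K. j \<le> M} = insert M K" using MK by auto
  \<comment> \<open>The right-hand side is the coefficient that the claim assigns to
    \<open>W\<close> and \<open>K\<close>; thus the induction hypothesis supplies precisely the
    missing factor \<open>y M\<close>.\<close>
  have yM: "y M = real (card W) - 2 * real (card K) - 1"
    using fW insert(1) M unfolding y_def VM KM by (simp add: W_def)
  have IH: "(\<Sum>c\<in>W - {\<mu>} - K. \<Prod>k\<in>K. y k - of_bool (c < k)) = y M * (\<Prod>k\<in>K. y k)"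
    using insert.IH[OF fW] insert.prems MK \<mu>M fW yM yW by (simp add: W_def subset_iff)
  define Z where "Z = {v\<in>V. M < v}"
  have split: "V - {\<mu>} - insert M K = (W - {\<mu>} - K) \<union> Z"
    using MK \<mu>M by (auto simp: W_def Z_def)
  have cardV: "card V = card W + 1 + card Z"
  proof -
    have "V = insert M W \<union> Z" using insert.prems by (auto simp: W_def Z_def)
    moreover have "card (insert M W \<union> Z) = card (insert M W) + card Z"
      using insert.prems fW by (intro card_Un_disjoint) (auto simp: W_def Z_def)
    ultimately show ?thesis using fW by (simp add: W_def)
  qed
  have "(\<Sum>c\<in>V - {\<mu>} - insert M K. \<Prod>k\<in>insert M K. y k - of_bool (c < k))
     = (\<Sum>c\<in>W - {\<mu>} - K. \<Prod>k\<in>insert M K. y k - of_bool (c < k))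
     + (\<Sum>c\<in>Z. \<Prod>k\<in>insert M K. y k - of_bool (c < k))"
    unfolding split using fW insert.prems(1)
    by (intro sum.union_disjoint) (auto simp: W_def Z_def)
  also have "(\<Sum>c\<in>W - {\<mu>} - K. \<Prod>k\<in>insert M K. y k - of_bool (c < k))
     = (y M - 1) * (\<Sum>c\<in>W - {\<mu>} - K. \<Prod>k\<in>K. y k - of_bool (c < k))"
    unfolding sum_distrib_left using insert(1) M by (intro sum.cong) (auto simp: W_def)
  also have "(\<Sum>c\<in>Z. \<Prod>k\<in>insert M K. y k - of_bool (c < k)) = (\<Sum>c\<in>Z. \<Prod>k\<in>insert M K. y k)"
    using MK by (intro sum.cong prod.cong) (auto simp: Z_def)
  also have "\<dots> = real (card Z) * (y M * (\<Prod>k\<in>K. y k))"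
    using insert(1) M by simp
  finally have "(\<Sum>c\<in>V - {\<mu>} - insert M K. \<Prod>k\<in>insert M K. y k - of_bool (c < k))
     = (y M - 1 + real (card Z)) * (y M * (\<Prod>k\<in>K. y k))"
    by (simp add: IH algebra_simps)
  moreover have "y M - 1 + real (card Z) = real (card V) - 2 * real (card (insert M K)) - 1"
    using yM cardV insert(1) M by simp
  ultimately show ?case using insert(1) M by (simp add: y_def)
qed

section \<open>Locality of the crossout procedure\<close>

lemma arg_min_on_cong:
  assumes "\<And>u. u \<in> U \<Longrightarrow> f u = g u"
  shows "arg_min_on f U = arg_min_on g U"
proof -
  have "is_arg_min f (\<lambda>x. x \<in> U) = is_arg_min g (\<lambda>x. x \<in> U)"
    using assms by (auto simp: is_arg_min_def fun_eq_iff)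
  then show ?thesis by (simp add: arg_min_on_def arg_min_def)
qed

lemma arg_min_on_eq:
  fixes f :: "'a \<Rightarrow> nat"
  assumes "finite U" "b \<in> U" "\<And>u. u \<in> U \<Longrightarrow> f b \<le> f u" "inj_on f U"
  shows "arg_min_on f U = b"
proof -
  have "arg_min_on f U \<in> U" "f (arg_min_on f U) \<le> f b"
    using assms arg_min_if_finite[of U f] by (auto simp: not_less)
  then show ?thesis using assms by (meson inj_onD le_antisym)
qed

text \<open>Each recursive call is on a subset of \<open>U\<close>, so only values on
  \<open>U\<close> are inspected. Values at removed positions can therefore be reset without
  changing later marks.\<close>

lemma crossout_A_cong:
  "(\<And>u. u \<in> U \<Longrightarrow> w u = w' u) \<Longrightarrow> crossout_A w U = crossout_A w' U"
proof (induction w U rule: crossout_A.induct)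
  case (1 w U)
  have eq: "arg_min_on w U = arg_min_on w' U"
    using "1.prems" by (rule arg_min_on_cong)
  show ?case
  proof (cases "finite U \<and> U \<noteq> {}")
    case True
    have "crossout_A w (U - {arg_min_on w U} - {Min (U - {arg_min_on w U})})
        = crossout_A w' (U - {arg_min_on w U} - {Min (U - {arg_min_on w U})})"
      by (rule "1.IH"[OF True refl refl]) (use "1.prems" in auto)
    then show ?thesis
      using True by (subst (1 2) crossout_A.simps) (simp add: eq Let_def)
  qed (subst (1 2) crossout_A.simps, auto)
qed

text \<open>Evenness persists through the rounds and excludes a singleton \<open>U\<close>, where A
  would be placed at the unspecified value \<open>Min {}\<close>.\<close>

lemma crossout_A_subset:
  "even (card U) \<Longrightarrow> crossout_A w U \<subseteq> U"
proof (induction w U rule: crossout_A.induct)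
  case (1 w U)
  show ?case
  proof (cases "finite U \<and> U \<noteq> {}")
    case True
    define b where "b = arg_min_on w U"
    define a where "a = Min (U - {b})"
    have b: "b \<in> U" using True b_def arg_min_if_finite(1) by blast
    have "U \<noteq> {b}" using "1.prems" by auto
    then have "U - {b} \<noteq> {}" using b by auto
    then have a: "a \<in> U - {b}" using True a_def by (metis Min_in finite_Diff)
    have "card (U - {b} - {a}) = card U - 2"
      using True a b by (simp add: card_Diff_singleton)
    then have "crossout_A w (U - {b} - {a}) \<subseteq> U - {b} - {a}"
      using "1.IH"[OF True b_def a_def] "1.prems" by simp
    then show ?thesis
      using True a b by (subst crossout_A.simps) (auto simp: Let_def simp flip: b_def a_def)
  qed (subst crossout_A.simps, auto)
qed

section \<open>Bijections from positions to values\<close>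

text \<open>Being the identity outside \<open>U\<close> makes the maps determined by their values on \<open>U\<close>, so that
  they can be counted.\<close>

definition arrangements :: "'a set \<Rightarrow> 'a set \<Rightarrow> ('a \<Rightarrow> 'a) set" where
  "arrangements U V = {w. bij_betw w U V \<and> (\<forall>x. x \<notin> U \<longrightarrow> w x = x)}"

lemma arrangements_self: "arrangements S S = {w. w permutes S}"
  by (auto simp: arrangements_def permutes_imp_bij permutes_not_in intro: bij_imp_permutes)

lemma finite_arrangements:
  assumes "finite U" "finite V"
  shows "finite (arrangements U V)"
proof -
  have "arrangements U V \<subseteq> (\<lambda>f x. if x \<in> U then f x else x) ` (U \<rightarrow>\<^sub>E V)"
  proof
    fix w assume w: "w \<in> arrangements U V"
    then have "restrict w U \<in> U \<rightarrow>\<^sub>E V" "w = (\<lambda>x. if x \<in> U then restrict w U x else x)"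
      by (auto simp: arrangements_def bij_betw_def)
    then show "w \<in> (\<lambda>f x. if x \<in> U then f x else x) ` (U \<rightarrow>\<^sub>E V)" by blast
  qed
  then show ?thesis
    using assms by (meson finite_PiE finite_imageI finite_subset)
qed

text \<open>Deleting a position together with its value; \<open>arrangements_insert\<close> is the
  reverse. Setting \<open>u\<close> to itself keeps the map the identity outside the smaller
  domain.\<close>

lemma arrangements_remove:
  assumes "w \<in> arrangements U V" "u \<in> U"
  shows "w(u := u) \<in> arrangements (U - {u}) (V - {w u})"
proof -
  have "bij_betw w (U - {u}) (V - {w u})"
    using assms by (auto simp: arrangements_def bij_betw_def inj_on_def)
  moreover have "bij_betw (w(u := u)) (U - {u}) (V - {w u}) = bij_betw w (U - {u}) (V - {w u})"
    by (rule bij_betw_cong) auto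
  ultimately show ?thesis using assms by (auto simp: arrangements_def)
qed

lemma arrangements_insert:
  assumes "w \<in> arrangements (U - {u}) (V - {v})" "u \<in> U" "v \<in> V"
  shows "w(u := v) \<in> arrangements U V"
proof -
  have "bij_betw (w(u := v)) (U - {u}) (V - {v}) = bij_betw w (U - {u}) (V - {v})"
    by (rule bij_betw_cong) auto
  then have "bij_betw (w(u := v)) (U - {u}) (V - {v})"
    using assms by (simp add: arrangements_def)
  then have "bij_betw (w(u := v)) U V"
    using notIn_Un_bij_betw[of u "U - {u}" "w(u := v)" "V - {v}"] assms
    by (simp add: insert_absorb)
  then show ?thesis using assms by (auto simp: arrangements_def)
qed

section \<open>The recursion for the number of favourable arrangements\<close>

text \<open>The event is expressed through an image rather than through \<open>inv w\<close>: after
  some rounds \<open>U\<close> and \<open>V\<close> may differ, and \<open>w\<close> need not be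
  injective on all of the naturals.\<close>

definition arrangements_marking_A :: "nat set \<Rightarrow> nat set \<Rightarrow> nat set \<Rightarrow> (nat \<Rightarrow> nat) set" where
  "arrangements_marking_A U V K = {w \<in> arrangements U V. K \<subseteq> w ` crossout_A w U}"

lemma crossout_A_step:
  assumes "finite U" "even (card U)" "w \<in> arrangements U V" "b \<in> U" "w b = Min V"
  shows "crossout_A w U = insert (Min (U - {b})) (crossout_A w (U - {b} - {Min (U - {b})}))"
proof -
  have V: "w ` U = V" "inj_on w U" using assms by (auto simp: arrangements_def bij_betw_def)
  then have "arg_min_on w U = b" using assms by (intro arg_min_on_eq) auto
  then show ?thesis using assms by (subst crossout_A.simps) (auto simp: Let_def)
qed

text \<open>The position \<open>a\<close> depends only on \<open>b\<close>, so once
  \<open>w b\<close> and \<open>w a\<close> are prescribed, the rest is an arbitrary arrangement of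
  the remaining values. Deleting both positions is a bijection. The value \<open>c\<close> is marked
  A in this round, so only \<open>K - {c}\<close> is still required.\<close>

lemma card_arrangements_marking_A_fiber:
  assumes U: "finite U" "even (card U)" and b: "b \<in> U" and V: "finite V" "\<mu> = Min V" "\<mu> \<in> V"
    and c: "c \<in> V" "c \<noteq> \<mu>" and K: "K \<subseteq> V" "\<mu> \<notin> K" and a: "a = Min (U - {b})"
  shows "card {w \<in> arrangements_marking_A U V K. w b = \<mu> \<and> w a = c}
       = card (arrangements_marking_A (U - {b} - {a}) (V - {\<mu>} - {c}) (K - {c}))"
proof -
  have "U \<noteq> {b}" using U by auto
  then have "U - {b} \<noteq> {}" using b by auto
  then have aU: "a \<in> U" "a \<noteq> b" using U a Min_in[of "U - {b}"] by auto
  let ?U = "U - {b} - {a}"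
  have evU: "even (card ?U)" using U aU b by (simp add: card_Diff_singleton)
  \<comment> \<open>The map \<open>w'\<close> is any map agreeing with \<open>w\<close> on the
    remaining positions, so that the equivalence serves both directions of the bijection.\<close>
  have key: "K \<subseteq> w ` crossout_A w U \<longleftrightarrow> K - {c} \<subseteq> w' ` crossout_A w' ?U"
    if w: "w \<in> arrangements U V" "w b = \<mu>" "w a = c" and w': "\<And>u. u \<in> ?U \<Longrightarrow> w u = w' u" for w w'
  proof -
    have "crossout_A w U = insert a (crossout_A w ?U)"
      using crossout_A_step[OF U w(1) b] w V a by simp
    moreover have "crossout_A w ?U = crossout_A w' ?U"
      using w' by (rule crossout_A_cong)
    moreover have "w ` crossout_A w' ?U = w' ` crossout_A w' ?U"
      using w' crossout_A_subset[OF evU, of w'] by (intro image_cong) auto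
    ultimately show ?thesis using w by auto
  qed
  have "bij_betw (\<lambda>w. w(b := b, a := a)) {w \<in> arrangements_marking_A U V K. w b = \<mu> \<and> w a = c}
          (arrangements_marking_A ?U (V - {\<mu>} - {c}) (K - {c}))"
  proof (rule bij_betw_byWitness[where f' = "\<lambda>w. w(a := c, b := \<mu>)"])
    show "\<forall>w\<in>{w \<in> arrangements_marking_A U V K. w b = \<mu> \<and> w a = c}. (w(b := b, a := a))(a := c, b := \<mu>) = w"
      by (auto simp: fun_eq_iff)
    show "\<forall>w\<in>arrangements_marking_A ?U (V - {\<mu>} - {c}) (K - {c}). (w(a := c, b := \<mu>))(b := b, a := a) = w"
      by (auto simp: arrangements_marking_A_def arrangements_def fun_eq_iff)
    show "(\<lambda>w. w(b := b, a := a)) ` {w \<in> arrangements_marking_A U V K. w b = \<mu> \<and> w a = c}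
            \<subseteq> arrangements_marking_A ?U (V - {\<mu>} - {c}) (K - {c})"
    proof clarify
      fix w assume w: "w \<in> arrangements_marking_A U V K" and eq: "\<mu> = w b" "c = w a"
      have arr: "w \<in> arrangements U V" using w by (simp add: arrangements_marking_A_def)
      have "w(b := b) \<in> arrangements (U - {b}) (V - {w b})"
        using arr b by (rule arrangements_remove)
      from arrangements_remove[OF this, of a]
      have "w(b := b, a := a) \<in> arrangements ?U (V - {w b} - {w a})"
        using aU by simp
      moreover have "K - {w a} \<subseteq> (w(b := b, a := a)) ` crossout_A (w(b := b, a := a)) ?U"
        using key[OF arr eq(1)[symmetric] eq(2)[symmetric], of "w(b := b, a := a)"] w eq
        by (auto simp: arrangements_marking_A_def)
      ultimately show "w(b := b, a := a) \<in> arrangements_marking_A ?U (V - {w b} - {w a}) (K - {w a})"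
        by (simp add: arrangements_marking_A_def)
    qed
    show "(\<lambda>w. w(a := c, b := \<mu>)) ` arrangements_marking_A ?U (V - {\<mu>} - {c}) (K - {c})
            \<subseteq> {w \<in> arrangements_marking_A U V K. w b = \<mu> \<and> w a = c}"
    proof clarify
      fix w assume w: "w \<in> arrangements_marking_A ?U (V - {\<mu>} - {c}) (K - {c})"
      then have "w \<in> arrangements ?U (V - {\<mu>} - {c})" by (simp add: arrangements_marking_A_def)
      then have "w(a := c) \<in> arrangements (U - {b}) (V - {\<mu>})"
        by (rule arrangements_insert) (use aU c in auto)
      then have arr: "w(a := c, b := \<mu>) \<in> arrangements U V"
        by (rule arrangements_insert) (use b V in auto)
      have "K \<subseteq> (w(a := c, b := \<mu>)) ` crossout_A (w(a := c, b := \<mu>)) U"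
        using key[OF arr, of w] aU w by (auto simp: arrangements_marking_A_def)
      then show "w(a := c, b := \<mu>) \<in> arrangements_marking_A U V K \<and> (w(a := c, b := \<mu>)) b = \<mu> \<and> (w(a := c, b := \<mu>)) a = c"
        using arr aU by (simp add: arrangements_marking_A_def)
    qed
  qed
  then show ?thesis by (rule bij_betw_same_card)
qed

text \<open>Partition by the position \<open>b\<close> of the smallest value and the value
  \<open>c\<close> at the position marked A in the first round, then count each class by the
  preceding bijection.\<close>

lemma card_arrangements_marking_A_rec:
  assumes U: "finite U" "even (card U)" and V: "finite V" "V \<noteq> {}"
    and K: "K \<subseteq> V" "Min V \<notin> K"
  shows "card (arrangements_marking_A U V K) = (\<Sum>b\<in>U. \<Sum>c\<in>V - {Min V}.
           card (arrangements_marking_A (U - {b} - {Min (U - {b})}) (V - {Min V} - {c}) (K - {c})))"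
proof -
  define a where "a = (\<lambda>b. Min (U - {b}))"
  define F where "F = (\<lambda>(b, c). {w \<in> arrangements_marking_A U V K. w b = Min V \<and> w (a b) = c})"
  let ?I = "U \<times> (V - {Min V})"
  have fin: "finite (arrangements_marking_A U V K)"
    using finite_arrangements[OF U(1) V(1)] by (simp add: arrangements_marking_A_def)
  have muV: "Min V \<in> V" using V by simp
  have "arrangements_marking_A U V K = (\<Union>p\<in>?I. F p)"
  proof (intro subset_antisym subsetI)
    fix w assume w: "w \<in> arrangements_marking_A U V K"
    then have bij: "bij_betw w U V" by (simp add: arrangements_marking_A_def arrangements_def)
    then obtain b where b: "b \<in> U" "w b = Min V"
      using muV by (metis bij_betw_iff_bijections)
    have "U \<noteq> {b}" using U by auto
    then have "U - {b} \<noteq> {}" using b by auto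
    then have "a b \<in> U" "a b \<noteq> b" using U Min_in[of "U - {b}"] by (auto simp: a_def)
    then have "w (a b) \<in> V - {Min V}"
      using bij b by (auto simp: bij_betw_def inj_on_def)
    then show "w \<in> (\<Union>p\<in>?I. F p)" using w b by (auto simp: F_def)
  qed (auto simp: F_def)
  moreover have "card (\<Union>p\<in>?I. F p) = (\<Sum>p\<in>?I. card (F p))"
  proof (rule card_UN_disjoint)
    show "\<forall>p\<in>?I. \<forall>q\<in>?I. p \<noteq> q \<longrightarrow> F p \<inter> F q = {}"
    proof (intro ballI impI)
      fix p q assume pq: "p \<in> ?I" "q \<in> ?I" "p \<noteq> q"
      \<comment> \<open>By injectivity \<open>w\<close> determines the position of
        \<open>Min V\<close>, hence also the value at the position marked A.\<close>
      have "p = q" if w: "w \<in> F p" "w \<in> F q" for w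
      proof -
        have "inj_on w U" using w by (auto simp: F_def arrangements_marking_A_def arrangements_def bij_betw_def)
        moreover have "w (fst p) = w (fst q)" using w by (auto simp: F_def)
        ultimately have "fst p = fst q" using pq by (auto dest: inj_onD)
        then show ?thesis using w by (auto simp: F_def)
      qed
      then show "F p \<inter> F q = {}" using pq by blast
    qed
  qed (use U V fin in \<open>auto simp: F_def\<close>)
  moreover have "(\<Sum>p\<in>?I. card (F p)) = (\<Sum>p\<in>?I.
      case p of (b, c) \<Rightarrow> card (arrangements_marking_A (U - {b} - {a b}) (V - {Min V} - {c}) (K - {c})))"
    using card_arrangements_marking_A_fiber[OF U _ V(1) refl muV _ _ K] by (intro sum.cong) (auto simp: F_def a_def)
  ultimately show ?thesis by (simp add: a_def sum.cartesian_product)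
qed

text \<open>The smallest value sits at the position marked B in the first round, and by injectivity
  at no other.\<close>

lemma arrangements_marking_A_empty_if_Min_mem:
  assumes "finite U" "even (card U)" "finite V" "V \<noteq> {}" "Min V \<in> K"
  shows "arrangements_marking_A U V K = {}"
proof (rule ccontr)
  assume "arrangements_marking_A U V K \<noteq> {}"
  then obtain w where w: "w \<in> arrangements U V" "K \<subseteq> w ` crossout_A w U"
    by (auto simp: arrangements_marking_A_def)
  then have bij: "bij_betw w U V" by (simp add: arrangements_def)
  then obtain b where b: "b \<in> U" "w b = Min V"
    using assms by (metis Min_in bij_betw_iff_bijections)
  let ?a = "Min (U - {b})"
  have "U \<noteq> {b}" using assms by auto
  then have "U - {b} \<noteq> {}" using b by auto
  then have a: "?a \<in> U" "?a \<noteq> b" using assms Min_in[of "U - {b}"] by auto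
  have "even (card (U - {b} - {?a}))" using assms a b by (simp add: card_Diff_singleton)
  then have "crossout_A w U \<subseteq> U - {b}"
    using crossout_A_step[OF assms(1,2) w(1) b] crossout_A_subset[of "U - {b} - {?a}" w] a by auto
  moreover obtain u where u: "u \<in> crossout_A w U" "w u = w b"
    using subsetD[OF w(2) assms(5)] b by auto
  ultimately have "u \<in> U" "u \<noteq> b" by auto
  then show False using bij b(1) u(2) by (meson bij_betw_imp_inj_on inj_onD)
qed

section \<open>The closed form\<close>

text \<open>Ranks within \<open>V\<close> and \<open>K\<close> replace the values themselves, so
  that the formula can be applied again after values have been deleted. If \<open>Min V\<close> lies
  in \<open>K\<close>, both sides vanish; otherwise the recursion reduces the claim to the two
  telescoping sums.\<close>

lemma card_arrangements_marking_A:
  assumes "finite U" "card U = 2 * n" "finite V" "card V = 2 * n" "K \<subseteq> V"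
  shows "real (card (arrangements_marking_A U V K)) = fact (2 * n)
    * (\<Prod>k\<in>K. real (card {v\<in>V. v \<le> k}) - 2 * real (card {j\<in>K. j \<le> k}) + 1)
    / (\<Prod>i=1..card K. 2 * real n - 2 * real i + 1)"
  using assms
proof (induction n arbitrary: U V K)
  case 0
  then have "U = {}" "V = {}" "K = {}" by auto
  then have "arrangements_marking_A U V K = {id}" by (auto simp: arrangements_marking_A_def arrangements_def)
  then show ?case using \<open>K = {}\<close> by simp
next
  case (Suc n)
  note prems = Suc.prems
  have fK: "finite K" using prems finite_subset by auto
  have V: "V \<noteq> {}" using prems by auto
  have evU: "even (card U)" using prems by simp
  define \<mu> where "\<mu> = Min V"
  have \<mu>: "\<mu> \<in> V" "\<forall>v\<in>V. \<mu> \<le> v" using V prems by (auto simp: \<mu>_def)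
  define x where "x = (\<lambda>k. real (card {v\<in>V. v \<le> k}) - 2 * real (card {j\<in>K. j \<le> k}))"
  define D where "D = (\<lambda>n m. \<Prod>i=1..m. 2 * real n - 2 * real i + 1)"
  show ?case
  proof (cases "\<mu> \<in> K")
    case True
    have "{v\<in>V. v \<le> \<mu>} = {\<mu>}" "{j\<in>K. j \<le> \<mu>} = {\<mu>}" using \<mu> True prems(5) by force+
    then have "x \<mu> + 1 = 0" by (simp add: x_def)
    then have "(\<Prod>k\<in>K. x k + 1) = 0" using True fK by auto
    moreover have "arrangements_marking_A U V K = {}"
      using arrangements_marking_A_empty_if_Min_mem[OF prems(1) evU prems(3) V] True by (simp add: \<mu>_def)
    ultimately show ?thesis by (simp add: x_def)
  next
    case False
    \<comment> \<open>The factors are odd integers. They can be negative, because \<open>K\<close>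
      may have more than \<open>n\<close> elements here.\<close>
    have D_nz: "D n m \<noteq> 0" for n m
    proof -
      have "2 * real n - 2 * real i + 1 \<noteq> 0" for i
      proof
        assume "2 * real n - 2 * real i + 1 = 0"
        then have "real (2 * n + 1) = real (2 * i)" by simp
        then have "2 * n + 1 = 2 * i" by (simp only: of_nat_eq_iff)
        then show False by presburger
      qed
      then show ?thesis by (simp add: D_def)
    qed
    have D_Suc: "D n (Suc m) = D n m * (2 * real n - 2 * real m - 1)" for n m
      by (simp add: D_def)
    have D_shift: "D (Suc n) (Suc m) = (2 * real n + 1) * D n m" for m
      by (induction m) (simp_all add: D_def algebra_simps)
    have inner: "real (card (arrangements_marking_A (U - {b} - {Min (U - {b})}) (V - {\<mu>} - {c}) (K - {c})))
        = fact (2 * n) * (if c \<in> K then (\<Prod>k\<in>K - {c}. x k + of_bool (c < k)) / D n (card K - 1)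
             else (\<Prod>k\<in>K. x k - of_bool (c < k)) / D n (card K))"
      if b: "b \<in> U" and c: "c \<in> V - {\<mu>}" for b c
    proof -
      have "U \<noteq> {b}" using evU by auto
      then have "U - {b} \<noteq> {}" using b by auto
      then have a: "Min (U - {b}) \<in> U - {b}" using prems by (intro Min_in) auto
      have cU: "card (U - {b} - {Min (U - {b})}) = 2 * n"
        using a b prems by (simp add: card_Diff_singleton)
      have cV: "card (V - {\<mu>} - {c}) = 2 * n"
        using c \<mu> prems by (simp add: card_Diff_singleton)
      \<comment> \<open>Deleting \<open>\<mu>\<close> lowers the rank in \<open>V\<close> by one,
        which cancels the \<open>+ 1\<close>. Deleting \<open>c\<close> below \<open>k\<close> costs
        one more, but gains two if \<open>c\<close> lies in \<open>K\<close>; this yields the raised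
        and the lowered factors.\<close>
      have fac: "real (card {v\<in>V - {\<mu>} - {c}. v \<le> k}) - 2 * real (card {j\<in>K - {c}. j \<le> k}) + 1
           = x k - of_bool (c < k) + 2 * of_bool (c < k \<and> c \<in> K)" if k: "k \<in> K - {c}" for k
      proof -
        have "{v\<in>V - {\<mu>} - {c}. v \<le> k} = {v\<in>V. v \<le> k} - {\<mu>} - {c}" by auto
        moreover have "\<mu> \<in> {v\<in>V. v \<le> k}" using \<mu> k prems by auto
        moreover have "card {v\<in>V. v \<le> k} = Suc (card ({v\<in>V. v \<le> k} - {\<mu>}))"
          using calculation(2) prems by (intro card.remove) auto
        moreover have "card ({v\<in>V. v \<le> k} - {\<mu>})
            = card ({v\<in>V. v \<le> k} - {\<mu>} - {c}) + of_bool (c < k)"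
        proof (cases "c < k")
          case True
          then have "c \<in> {v\<in>V. v \<le> k} - {\<mu>}" using c by auto
          then show ?thesis using True prems card.remove[of "{v\<in>V. v \<le> k} - {\<mu>}" c] by simp
        next
          case False
          then have "{v\<in>V. v \<le> k} - {\<mu>} - {c} = {v\<in>V. v \<le> k} - {\<mu>}" using k by auto
          then show ?thesis using False by simp
        qed
        moreover have "card {j\<in>K. j \<le> k} = card {j\<in>K - {c}. j \<le> k} + of_bool (c < k \<and> c \<in> K)"
        proof (cases "c < k \<and> c \<in> K")
          case True
          then have "c \<in> {j\<in>K. j \<le> k}" by auto
          moreover have "{j\<in>K - {c}. j \<le> k} = {j\<in>K. j \<le> k} - {c}" by auto
          ultimately show ?thesis using True fK card.remove[of "{j\<in>K. j \<le> k}" c] by simp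
        next
          case False
          then have "{j\<in>K - {c}. j \<le> k} = {j\<in>K. j \<le> k}" using k by auto
          then show ?thesis using False by simp
        qed
        ultimately show ?thesis by (simp add: x_def)
      qed
      have "real (card (arrangements_marking_A (U - {b} - {Min (U - {b})}) (V - {\<mu>} - {c}) (K - {c})))
        = fact (2 * n) * (\<Prod>k\<in>K - {c}. x k - of_bool (c < k) + 2 * of_bool (c < k \<and> c \<in> K))
            / D n (card (K - {c}))"
        using Suc.IH[OF _ cU _ cV, of "K - {c}"] prems False fac by (auto simp: D_def)
      then show ?thesis
        using fK by (auto simp: algebra_simps intro!: prod.cong)
    qed
    have "real (card (arrangements_marking_A U V K)) = (\<Sum>b\<in>U. \<Sum>c\<in>V - {\<mu>}.
        real (card (arrangements_marking_A (U - {b} - {Min (U - {b})}) (V - {\<mu>} - {c}) (K - {c}))))"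
      using card_arrangements_marking_A_rec[OF prems(1) evU prems(3) V prems(5)] False by (simp add: \<mu>_def)
    also have "\<dots> = (\<Sum>b\<in>U. \<Sum>c\<in>V - {\<mu>}. fact (2 * n) *
        (if c \<in> K then (\<Prod>k\<in>K - {c}. x k + of_bool (c < k)) / D n (card K - 1)
             else (\<Prod>k\<in>K. x k - of_bool (c < k)) / D n (card K)))"
      by (intro sum.cong refl inner)
    \<comment> \<open>The summand does not depend on \<open>b\<close>, so the outer sum contributes
      the factor \<open>card U\<close>.\<close>
    also have "\<dots> = 2 * (real n + 1) * fact (2 * n) * (\<Sum>c\<in>V - {\<mu>}.
        (if c \<in> K then (\<Prod>k\<in>K - {c}. x k + of_bool (c < k)) / D n (card K - 1)
             else (\<Prod>k\<in>K. x k - of_bool (c < k)) / D n (card K)))"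
      using prems by (simp add: algebra_simps flip: sum_distrib_left)
    also have "(\<Sum>c\<in>V - {\<mu>}.
        (if c \<in> K then (\<Prod>k\<in>K - {c}. x k + of_bool (c < k)) / D n (card K - 1)
             else (\<Prod>k\<in>K. x k - of_bool (c < k)) / D n (card K)))
        = (\<Sum>c\<in>K. \<Prod>k\<in>K - {c}. x k + of_bool (c < k)) / D n (card K - 1)
        + (\<Sum>c\<in>V - {\<mu>} - K. \<Prod>k\<in>K. x k - of_bool (c < k)) / D n (card K)"
    proof -
      have "K \<subseteq> V - {\<mu>}" using False prems by auto
      moreover have "finite (V - {\<mu>})" using prems by simp
      ultimately show ?thesis
        by (subst sum.subset_diff[of K]) (simp_all add: sum_divide_distrib)
    qed
    also have "\<dots> = ((\<Prod>k\<in>K. x k + 1) - (\<Prod>k\<in>K. x k)) / D n (card K - 1)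
        + (2 * real n + 1 - 2 * real (card K)) * (\<Prod>k\<in>K. x k) / D n (card K)"
    proof -
      have "(\<Sum>c\<in>V - {\<mu>} - K. \<Prod>k\<in>K. x k - of_bool (c < k))
        = (2 * real n + 1 - 2 * real (card K)) * (\<Prod>k\<in>K. x k)"
        using sum_prod_lower_above[OF fK prems(3) prems(5) \<mu> False] prems(4)
        by (simp add: x_def algebra_simps)
      then show ?thesis using sum_prod_raise_above[OF fK, of x] by simp
    qed
    \<comment> \<open>For nonempty \<open>K\<close>, the coefficient of the second term is the last
      factor of \<open>D n (card K)\<close>. After cancelling it, the two terms in
      \<open>\<Prod>k\<in>K. x k\<close> cancel each other. Empty \<open>K\<close> is separate
      because \<open>card K - 1\<close> is then truncated.\<close>
    also have "\<dots> = (2 * real n + 1) * (\<Prod>k\<in>K. x k + 1) / D (Suc n) (card K)"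
    proof (cases "card K")
      case 0
      then have "K = {}" using fK by simp
      then show ?thesis by (simp add: D_def)
    next
      case (Suc m)
      have nz: "2 * real n - 2 * real m - 1 \<noteq> 0" using D_nz[of n "Suc m"] by (auto simp: D_Suc)
      have "(2 * real n + 1 - 2 * real (card K)) * (\<Prod>k\<in>K. x k) / D n (card K) = (\<Prod>k\<in>K. x k) / D n m"
        using nz D_nz[of n m] Suc by (simp add: D_Suc)
      then show ?thesis using Suc D_nz[of n m] by (simp add: D_shift diff_divide_distrib)
    qed
    finally have "real (card (arrangements_marking_A U V K))
        = 2 * (real n + 1) * fact (2 * n) * ((2 * real n + 1) * (\<Prod>k\<in>K. x k + 1) / D (Suc n) (card K))" .
    moreover have "fact (2 * Suc n) = 2 * (real n + 1) * (2 * real n + 1) * fact (2 * n)"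
      by (simp add: algebra_simps)
    ultimately show ?thesis by (simp add: x_def D_def)
  qed
qed

section \<open>The probability for a random permutation\<close>

theorem theorem9:
  fixes n m :: nat and k :: "nat \<Rightarrow> nat"
  assumes "n \<ge> 1" and "1 \<le> m" and "m \<le> n"
    and "strict_mono_on {1..m} k"
    and "\<And>i. i \<in> {1..m} \<Longrightarrow> 1 \<le> k i \<and> k i \<le> 2 * n"
  shows "measure_pmf.prob (pmf_of_set {w. w permutes {1..2 * n}})
           {w. \<forall>i\<in>{1..m}. inv w (k i) \<in> alice_set n w}
         = (\<Prod>i=1..m. (real (k i) - 2 * real i + 1) / (2 * real n - 2 * real i + 1))"
proof -
  let ?S = "{1..2 * n}"
  define K where "K = k ` {1..m}"
  have inj: "inj_on k {1..m}" using assms(4) by (rule strict_mono_on_imp_inj_on)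
  have cK: "card K = m" using card_image[OF inj] by (simp add: K_def)
  have KS: "K \<subseteq> ?S" using assms(5) by (auto simp: K_def)
  have event: "{w. w permutes ?S} \<inter> {w. \<forall>i\<in>{1..m}. inv w (k i) \<in> alice_set n w} = arrangements_marking_A ?S ?S K"
  proof -
    have "inv w j \<in> A \<longleftrightarrow> j \<in> w ` A" if "w permutes ?S" for w j A
      using that by (metis image_iff permutes_inverses)
    then show ?thesis by (auto simp: arrangements_marking_A_def arrangements_self alice_set_def K_def)
  qed
  have fin: "finite {w. w permutes ?S}" by (simp add: finite_permutations)
  have ne: "{w. w permutes ?S} \<noteq> {}" using permutes_id by blast
  have "measure_pmf.prob (pmf_of_set {w. w permutes ?S})
           {w. \<forall>i\<in>{1..m}. inv w (k i) \<in> alice_set n w} = real (card (arrangements_marking_A ?S ?S K)) / fact (2 * n)"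
    unfolding measure_pmf_of_set[OF ne fin] event by (simp add: card_permutations[OF refl])
  also have "\<dots> = (\<Prod>j\<in>K. real (card {v\<in>?S. v \<le> j}) - 2 * real (card {l\<in>K. l \<le> j}) + 1)
      / (\<Prod>i=1..m. 2 * real n - 2 * real i + 1)"
    using card_arrangements_marking_A[of ?S n ?S K] KS cK by simp
  also have "(\<Prod>j\<in>K. real (card {v\<in>?S. v \<le> j}) - 2 * real (card {l\<in>K. l \<le> j}) + 1)
      = (\<Prod>i=1..m. real (k i) - 2 * real i + 1)"
    unfolding K_def
  proof (subst prod.reindex[OF inj], intro prod.cong refl, unfold o_def)
    fix i assume i: "i \<in> {1..m}"
    \<comment> \<open>In the full value set \<open>k i\<close> has rank \<open>k i\<close>, and by
      strict monotonicity it has rank \<open>i\<close> within \<open>K\<close>.\<close>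
    have "{v\<in>?S. v \<le> k i} = {1..k i}" using assms(5)[OF i] by auto
    moreover have "{l\<in>k ` {1..m}. l \<le> k i} = k ` {1..i}"
    proof -
      have "k j \<le> k i \<longleftrightarrow> j \<le> i" if "j \<in> {1..m}" for j
        using assms(4) i that by (simp add: strict_mono_on_less_eq)
      then show ?thesis using i by auto
    qed
    moreover have "card (k ` {1..i}) = i"
      using i inj by (subst card_image) (auto intro: inj_on_subset)
    ultimately show "real (card {v\<in>?S. v \<le> k i}) - 2 * real (card {l\<in>k ` {1..m}. l \<le> k i}) + 1
        = real (k i) - 2 * real i + 1" by simp
  qed
  finally show ?thesis by (simp add: prod_dividef)
qed

end
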